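(* Let $q$ and $s$ be indeterminates and consider linear operators on the space of polynomials in $x$ (with coefficients rational functions in $q,s$). Let $X$ be multiplication by $x$, i.e. $Xf(x)=xf(x)$, and let $D_q$ be the $q$-differentiation operator $D_qf(x)=\frac{f(qx)-f(x)}{(q-1)x}$. For a polynomial $g(x)$, let $g(X)$ denote the operator of multiplication by $g(x)$. Then for every $n\ge 0$, $$(X+q^{n-1}sD_q)(X+q^{n-2}sD_q)\cdots(X+sD_q)=\sum_{k=0}^n g_n(k,X,s)\,s^kD_q^k,$$ where $$g_n(k,x,s)=\begin{bmatrix} n\\ k\end{bmatrix}\sum_{j=0}^{\lfloor (n-k)/2\rfloor} s^j q^{j^2+kj+\binom{k}{2}}\begin{bmatrix} n-k\\ 2j\end{bmatrix}[2j-1]!!\prod_{i=0}^{k-1}\frac{1+q^{n-j-i}}{1+q^{j+1+i}}\,x^{n-k-2j}.$$ In particular, for $k=0$, $g_n(0,x,s)=h_n(x,s)$, where $$h_n(x,s)=\sum_{j=0}^{\lfloor n/2\rfloor} q^{j^2}s^j\frac{[n]!}{(1+q)(1+q^2)\cdots(1+q^j)\,[j]!\,[n-2j]!}x^{n-2j}.$$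
   Context: Notation: $[n]=\frac{1-q^n}{1-q}=1+q+\cdots+q^{n-1}$, $[n]!=[1][2]\cdots[n]$ with $[0]!=1$, and $\begin{bmatrix} n\\ k\end{bmatrix}=\frac{[n]!}{[k]![n-k]!}$ is the $q$-binomial (Gaussian) coefficient. Also $[2j-1]!!=[1][3]\cdots[2j-1]$ (equal to $1$ for $j=0$), so that $\begin{bmatrix} n\\ 2j\end{bmatrix}[2j-1]!!=\frac{[n]!}{(1+q)(1+q^2)\cdots(1+q^j)[j]![n-2j]!}$. $\binom{k}{2}=k(k-1)/2$ is the ordinary binomial coefficient. *)

theory Defs
  imports
    "HOL-Computational_Algebra.Polynomial"
    "HOL-Computational_Algebra.Fraction_Field"
begin

text \<open>
  The field of rational functions in two indeterminates over an arbitrary field, realised as the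
  fraction field of \<open>k[q][s]\<close>: \<open>q\<close> is the inner polynomial variable, \<open>s\<close> the outer one.
\<close>

type_synonym 'k ratfun2 = "'k poly poly fract"

definition q_indet :: "'k::field ratfun2" where
  "q_indet = Fract [:[:0, 1:]:] 1"

definition s_indet :: "'k::field ratfun2" where
  "s_indet = Fract [:0, 1:] 1"

definition qnum :: "'a::field \<Rightarrow> nat \<Rightarrow> 'a" where
  "qnum q n = (1 - q ^ n) / (1 - q)"

definition qfact :: "'a::field \<Rightarrow> nat \<Rightarrow> 'a" where
  "qfact q n = (\<Prod>i=1..n. qnum q i)"

text \<open>Meant for \<open>k \<le> n\<close> only; it is not set to \<open>0\<close> for \<open>k > n\<close>.\<close>

definition qbinom :: "'a::field \<Rightarrow> nat \<Rightarrow> nat \<Rightarrow> 'a" where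
  "qbinom q n k = qfact q n / (qfact q k * qfact q (n - k))"

text \<open>\<open>qodd_dfact q j\<close> is \<open>[2j-1]!! = [1][3]\<cdots>[2j-1]\<close>, indexed by \<open>j\<close>.\<close>

definition qodd_dfact :: "'a::field \<Rightarrow> nat \<Rightarrow> 'a" where
  "qodd_dfact q j = (\<Prod>i=1..j. qnum q (2 * i - 1))"

text \<open>
  \<open>D\<^sub>q f(x) = (f(qx) - f(x)) / ((q - 1) x)\<close> as a polynomial quotient; the division is exact
  whenever \<open>q \<noteq> 1\<close>, as the lemma below records.
\<close>

definition qderiv :: "'a::field \<Rightarrow> 'a poly \<Rightarrow> 'a poly" where
  "qderiv q f = (pcompose f [:0, q:] - f) div [:0, q - 1:]"

lemma qderiv_exact:
  fixes q :: "'a::field"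
  assumes "q \<noteq> 1"
  shows "[:0, q - 1:] * qderiv q f = pcompose f [:0, q:] - f"
proof -
  have "poly (pcompose f [:0, q:] - f) 0 = 0"
    by (simp add: poly_pcompose)
  then have "[:0, 1:] dvd pcompose f [:0, q:] - f"
    by (simp only: poly_eq_0_iff_dvd minus_zero)
  then have "smult (q - 1) [:0, 1:] dvd pcompose f [:0, q:] - f"
    using assms by (subst smult_dvd_iff) simp
  then have "[:0, q - 1:] dvd pcompose f [:0, q:] - f"
    by simp
  then show ?thesis
    unfolding qderiv_def by (rule dvd_mult_div_cancel)
qed

definition mult_op :: "'a::field poly \<Rightarrow> 'a poly \<Rightarrow> 'a poly" where
  "mult_op g = (\<lambda>f. g * f)"

abbreviation X_op :: "'a::field poly \<Rightarrow> 'a poly" where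
  "X_op \<equiv> mult_op [:0, 1:]"

text \<open>
  \<open>op_prod q s n = (X + q\<^bsup>n-1\<^esup> s D\<^sub>q) \<circ> \<cdots> \<circ> (X + q s D\<^sub>q) \<circ> (X + s D\<^sub>q)\<close>; the factors do not
  commute, and the one with the highest power of \<open>q\<close> is applied last.
\<close>

primrec op_prod :: "'a::field \<Rightarrow> 'a \<Rightarrow> nat \<Rightarrow> 'a poly \<Rightarrow> 'a poly" where
  "op_prod q s 0 = id"
| "op_prod q s (Suc n) = (\<lambda>f. X_op f + smult (q ^ n * s) (qderiv q f)) \<circ> op_prod q s n"

text \<open>
  \<open>g_poly q s n k\<close> is \<open>g\<^sub>n(k, x, s)\<close> and \<open>h_poly q s n\<close> is \<open>h\<^sub>n(x, s)\<close>, as polynomials in \<open>x\<close>.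
  For \<open>k \<le> n\<close> no natural-number subtraction below is truncated.
\<close>

definition g_poly :: "'a::field \<Rightarrow> 'a \<Rightarrow> nat \<Rightarrow> nat \<Rightarrow> 'a poly" where
  "g_poly q s n k =
     smult (qbinom q n k)
       (\<Sum>j=0..(n - k) div 2.
          monom (s ^ j * q ^ (j\<^sup>2 + k * j + (k choose 2))
                 * qbinom q (n - k) (2 * j) * qodd_dfact q j
                 * (\<Prod>i<k. (1 + q ^ (n - j - i)) / (1 + q ^ (j + 1 + i))))
                (n - k - 2 * j))"

definition h_poly :: "'a::field \<Rightarrow> 'a \<Rightarrow> nat \<Rightarrow> 'a poly" where
  "h_poly q s n =
     (\<Sum>j=0..n div 2.
        monom (q ^ (j\<^sup>2) * s ^ j
               * (qfact q n / ((\<Prod>i=1..j. 1 + q ^ i) * qfact q j * qfact q (n - 2 * j))))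
              (n - 2 * j))"

end

theory Submission
  imports Defs
begin

text \<open>
  Write \<open>B(n) = (1 + q) \<cdots> (1 + q\<^sup>n)\<close>. With \<open>m = n - k - 2j\<close>, the coefficient of
  \<open>s\<^bsup>j+k\<^esup> x\<^sup>m D\<^sub>q\<^sup>k\<close> in the claimed expansion becomes the more symmetric
  \<open>F(m,k,j) = q\<^bsup>j\<^sup>2+kj+binom(k,2)\<^esup> [m+k+2j]! B(m+k+j) / ([k]! [m]! [j]! B(m+j) B(j+k))\<close>.
  By the \<open>q\<close>-Leibniz rule, multiplying on the left by \<open>X + q\<^sup>n s D\<^sub>q\<close> amounts to
  \<open>F(m,k,j) = F(m-1,k,j) + q\<^bsup>m+k+2j-1\<^esup> [m+1] F(m+1,k,j-1) + q\<^bsup>2m+k+2j-1\<^esup> F(m,k-1,j)\<close>.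
  After division by the common factor this is, with \<open>M = q\<^sup>m\<close>, \<open>K = q\<^sup>k\<close>, \<open>J = q\<^sup>j\<close>, the identity
  \<open>(1 - MKJ\<^sup>2)(1 + MKJ) = (1 - M)(1 + MJ) + M(1 - J)(1 + JK)(1 + MKJ) + M\<^sup>2J(1 - K)(1 + JK)\<close>.
  The only property of \<open>q\<close> that matters is that it is not a root of unity.
\<close>

section \<open>q-factorials and the products of the factors 1 + q^i\<close>

lemma qnum_0 [simp]: "qnum q 0 = 0"
  by (simp add: qnum_def)

lemma qfact_0 [simp]: "qfact q 0 = 1"
  by (simp add: qfact_def)

lemma qfact_Suc: "qfact q (Suc n) = qfact q n * qnum q (Suc n)"
  by (simp add: qfact_def)

definition qplus_prod :: "'a::field \<Rightarrow> nat \<Rightarrow> 'a" where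
  "qplus_prod q n = (\<Prod>i=1..n. 1 + q ^ i)"

lemma qplus_prod_0 [simp]: "qplus_prod q 0 = 1"
  by (simp add: qplus_prod_def)

lemma qplus_prod_Suc: "qplus_prod q (Suc n) = qplus_prod q n * (1 + q ^ Suc n)"
  by (simp add: qplus_prod_def)

text \<open>This splitting and its descending variant below turn the denominator and the numerator
  of the product in \<open>g_poly\<close> into quotients of values of
  \<open>qplus_prod\<close>.\<close>

lemma qplus_prod_add: "qplus_prod q (n + k) = qplus_prod q n * (\<Prod>i<k. 1 + q ^ (n + 1 + i))"
  by (induction k) (simp_all add: qplus_prod_Suc mult.assoc)

lemma qplus_prod_add_rev: "qplus_prod q (n + k) = qplus_prod q n * (\<Prod>i<k. 1 + q ^ (n + k - i))"
proof -
  have "(\<Prod>i<k. 1 + q ^ (n + 1 + i)) = (\<Prod>i<k. 1 + q ^ (n + 1 + (k - Suc i)))"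
    by (rule prod.nat_diff_reindex [symmetric])
  also have "\<dots> = (\<Prod>i<k. 1 + q ^ (n + k - i))"
    by (rule prod.cong[OF refl], rule arg_cong[where f = "\<lambda>e. 1 + q ^ e"]) auto
  finally show ?thesis
    by (simp only: qplus_prod_add)
qed

lemma qnum_double: "qnum q (2 * n) = (1 + q ^ n) * qnum q n"
proof -
  have "1 - q ^ (2 * n) = (1 + q ^ n) * (1 - q ^ n)"
    by (simp only: mult_2 power_add) (simp add: algebra_simps)
  then show ?thesis
    by (simp add: qnum_def)
qed

text \<open>The even factors split as [2i] = (1 + q^i)[i] and contribute
  \<open>qplus_prod q j * qfact q j\<close>; the odd ones form the double factorial.\<close>

lemma qfact_double: "qfact q (2 * j) = qodd_dfact q j * qplus_prod q j * qfact q j"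
proof (induction j)
  case 0
  then show ?case by (simp add: qodd_dfact_def)
next
  case (Suc j)
  have odd: "qodd_dfact q (Suc j) = qodd_dfact q j * qnum q (2 * j + 1)"
    by (simp add: qodd_dfact_def)
  have "qfact q (2 * Suc j) = qfact q (2 * j) * qnum q (2 * j + 1) * qnum q (2 * Suc j)"
    by (simp add: qfact_Suc)
  also have "\<dots> = qodd_dfact q (Suc j) * qplus_prod q (Suc j) * qfact q (Suc j)"
    by (simp add: Suc.IH qnum_double qfact_Suc qplus_prod_Suc odd del: mult_Suc_right)
  finally show ?case .
qed

section \<open>The q-derivative and its Leibniz rule\<close>

lemma smult_sum_right: "smult c (\<Sum>i\<in>A. f i) = (\<Sum>i\<in>A. smult c (f i))"
  by (induction A rule: infinite_finite_induct) (simp_all add: smult_add_right)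

lemma smult_monom_mult: "smult a (monom b m * p) = monom (a * b) m * p"
  by (simp add: smult_monom flip: mult_smult_left)

lemma pcompose_monom_scale:
  fixes q :: "'a::field"
  shows "pcompose (monom c m) [:0, q:] = monom (c * q ^ m) m"
  by (induction m) (simp_all add: monom_0 monom_Suc pcompose_pCons smult_monom ac_simps)

lemma qderiv_eqI:
  fixes q :: "'a::field"
  assumes "q \<noteq> 1" and "[:0, q - 1:] * g = pcompose f [:0, q:] - f"
  shows "qderiv q f = g"
  unfolding qderiv_def assms(2)[symmetric] using assms(1) by (intro nonzero_mult_div_cancel_left) auto

lemma qderiv_0 [simp]: "qderiv q 0 = 0"
  by (simp add: qderiv_def)

lemma qderiv_add:
  fixes q :: "'a::field"
  assumes "q \<noteq> 1"
  shows "qderiv q (f + g) = qderiv q f + qderiv q g"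
  by (rule qderiv_eqI[OF assms])
     (simp only: distrib_left qderiv_exact[OF assms] pcompose_add add_diff_add)

lemma qderiv_sum:
  fixes q :: "'a::field"
  assumes "q \<noteq> 1"
  shows "qderiv q (\<Sum>i\<in>A. f i) = (\<Sum>i\<in>A. qderiv q (f i))"
  by (induction A rule: infinite_finite_induct) (simp_all add: qderiv_add[OF assms])

text \<open>The rule D(gf) = (Dg) f + g(qx) Df for a monomial g, checked after multiplication by (q
  - 1)x, where the two copies of g(qx) f cancel. The truncated \<open>m - 1\<close> at m = 0 is
  harmless because \<open>qnum q 0 = 0\<close>.\<close>

lemma qderiv_monom_mult:
  fixes q :: "'a::field"
  assumes "q \<noteq> 1"
  shows "qderiv q (monom c m * f) =
           monom (c * qnum q m) (m - 1) * f + monom (c * q ^ m) m * qderiv q f"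
proof (rule qderiv_eqI[OF assms])
  have lin: "[:0, q - 1:] = monom (q - 1) 1"
    by (simp add: monom_altdef)
  have num: "(q - 1) * qnum q m = q ^ m - 1"
    using assms by (simp add: qnum_def field_simps)
  have "[:0, q - 1:] * monom (c * qnum q m) (m - 1) = monom (c * ((q - 1) * qnum q m)) m"
    unfolding lin by (cases m) (simp_all add: mult_monom ac_simps)
  also have "\<dots> = monom (c * q ^ m) m - monom c m"
    by (simp add: num diff_monom right_diff_distrib)
  finally have 1: "[:0, q - 1:] * (monom (c * qnum q m) (m - 1) * f)
      = (monom (c * q ^ m) m - monom c m) * f"
    by (simp only: mult.assoc [symmetric])
  have 2: "[:0, q - 1:] * (monom (c * q ^ m) m * qderiv q f)
      = monom (c * q ^ m) m * (pcompose f [:0, q:] - f)"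
    by (simp only: mult.left_commute qderiv_exact[OF assms, symmetric])
  show "[:0, q - 1:] * (monom (c * qnum q m) (m - 1) * f + monom (c * q ^ m) m * qderiv q f)
      = pcompose (monom c m * f) [:0, q:] - monom c m * f"
    unfolding distrib_left 1 2 pcompose_mult pcompose_monom_scale
    by (simp add: algebra_simps)
qed

section \<open>Coefficients of the normal-ordered product and their recurrence\<close>

definition normal_coeff :: "'a::field \<Rightarrow> nat \<Rightarrow> nat \<Rightarrow> nat \<Rightarrow> 'a" where
  "normal_coeff q m k j =
     q ^ (j\<^sup>2 + k * j + (k choose 2)) * qfact q (m + k + 2 * j) * qplus_prod q (m + k + j) /
     (qfact q k * qfact q m * qfact q j * qplus_prod q (m + j) * qplus_prod q (j + k))"

context
  fixes q :: "'a::field"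
  assumes not_root_of_unity: "\<And>i. i > 0 \<Longrightarrow> q ^ i \<noteq> 1"
begin

lemma q_neq_1: "q \<noteq> 1"
  using not_root_of_unity[of 1] by simp

lemma qnum_nonzero: "n > 0 \<Longrightarrow> qnum q n \<noteq> 0"
  using not_root_of_unity[of n] q_neq_1 by (simp add: qnum_def)

text \<open>1 + q^n divides [2n], which is nonzero.\<close>

lemma one_plus_power_nonzero: "n > 0 \<Longrightarrow> 1 + q ^ n \<noteq> 0"
  using qnum_nonzero[of "2 * n"] by (auto simp: qnum_double)

lemma qfact_nonzero: "qfact q n \<noteq> 0"
  using qnum_nonzero by (simp add: qfact_def)

lemma qplus_prod_nonzero: "qplus_prod q n \<noteq> 0"
  using one_plus_power_nonzero by (simp add: qplus_prod_def)

lemma normal_coeff_identity: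
  "qnum q (m + k + 2 * j) * (1 + q ^ (m + k + j)) =
     qnum q m * (1 + q ^ (m + j))
     + q ^ m * qnum q j * (1 + q ^ (j + k)) * (1 + q ^ (m + k + j))
     + q ^ (2 * m + j) * qnum q k * (1 + q ^ (j + k))"
proof -
  define M K J where "M = q ^ m" and "K = q ^ k" and "J = q ^ j"
  have "(1 - M * K * J\<^sup>2) * (1 + M * K * J) =
      (1 - M) * (1 + M * J) + M * (1 - J) * (1 + J * K) * (1 + M * K * J)
      + M\<^sup>2 * J * (1 - K) * (1 + J * K)"
    by algebra
  moreover have "q ^ (2 * m) = M\<^sup>2" "q ^ (2 * j) = J\<^sup>2"
    by (simp_all add: M_def J_def power_even_eq)
  ultimately show ?thesis
    using q_neq_1 unfolding qnum_def power_add M_def[symmetric] K_def[symmetric] J_def[symmetric]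
    by (simp add: add_divide_distrib[symmetric])
qed

text \<open>The summands record the three ways to reach x^m D^k from the previous product: X raises
  the power of x, D lowers it, or D passes through x^m, gaining q^m and raising the order of the
  derivative. The guards exclude truncated predecessors.\<close>

lemma normal_coeff_recurrence:
  assumes "m + k + 2 * j = Suc n"
  shows "normal_coeff q m k j =
           (if m = 0 then 0 else normal_coeff q (m - 1) k j)
           + (if j = 0 then 0 else q ^ n * qnum q (m + 1) * normal_coeff q (m + 1) k (j - 1))
           + (if k = 0 then 0 else q ^ (n + m) * normal_coeff q m (k - 1) j)"
    (is "_ = ?T1 + ?T2 + ?T3")
proof -
  note nz = qfact_nonzero qplus_prod_nonzero qnum_nonzero one_plus_power_nonzero
  \<comment> \<open>The coefficient without its factors [n+1] and 1 + q^(m+k+j). Each term of the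
    recurrence is \<open>C\<close> times the matching term of \<open>normal_coeff_identity\<close>;
    where a guard applies, that term vanishes too because \<open>qnum q 0 = 0\<close>.\<close>
  define C where "C = q ^ (j\<^sup>2 + k * j + (k choose 2)) * qfact q n * qplus_prod q (m + k + j - 1) /
     (qfact q k * qfact q m * qfact q j * qplus_prod q (m + j) * qplus_prod q (j + k))"
  \<comment> \<open>Since m + k + 2j is positive, so is m + k + j, and the predecessor in
    \<open>C\<close> is not truncated.\<close>
  obtain r where r: "m + k + j = Suc r"
    using assms by (cases "m + k + j") auto
  have "normal_coeff q m k j = C * (qnum q (m + k + 2 * j) * (1 + q ^ (m + k + j)))"
    unfolding normal_coeff_def C_def assms r by (simp add: qfact_Suc qplus_prod_Suc)
  moreover have "?T1 = C * (qnum q m * (1 + q ^ (m + j)))"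
  proof (cases m)
    case (Suc m')
    then have "n = m' + k + 2 * j" using assms by simp
    with Suc show ?thesis
      using qnum_nonzero[of "Suc m'"] one_plus_power_nonzero[of "Suc (m' + j)"]
      by (simp add: normal_coeff_def C_def qfact_Suc qplus_prod_Suc nz divide_simps
               del: power_Suc)
  qed simp
  moreover have "?T2 = C * (q ^ m * qnum q j * (1 + q ^ (j + k)) * (1 + q ^ (m + k + j)))"
  proof (cases j)
    case (Suc i)
    have n: "n = m + k + 2 * i + 1" using assms Suc by simp
    \<comment> \<open>With j = i + 1, j^2 + kj exceeds i^2 + ki by 2i + 1 + k = n - m.\<close>
    have e: "q ^ n * q ^ (i\<^sup>2 + k * i + (k choose 2)) = q ^ m * q ^ (j\<^sup>2 + k * j + (k choose 2))"
      unfolding power_add[symmetric] n Suc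
      by (rule arg_cong[where f = "\<lambda>e. q ^ e"]) (simp add: power2_eq_square algebra_simps)
    have "?T2 = (q ^ n * q ^ (i\<^sup>2 + k * i + (k choose 2))) * qnum q (Suc m) * qfact q n
       * qplus_prod q (Suc (m + k + i)) /
       (qfact q k * qfact q (Suc m) * qfact q i * qplus_prod q (m + j) * qplus_prod q (i + k))"
      using Suc by (simp add: normal_coeff_def n)
    also have "\<dots> = C * (q ^ m * qnum q j * (1 + q ^ (j + k)) * (1 + q ^ (m + k + j)))"
      unfolding e C_def using Suc qnum_nonzero[of "Suc m"] qnum_nonzero[of "Suc i"]
        one_plus_power_nonzero[of "Suc (i + k)"]
      by (simp add: qfact_Suc qplus_prod_Suc nz divide_simps del: power_Suc)
    finally show ?thesis .
  qed simp
  moreover have "?T3 = C * (q ^ (2 * m + j) * qnum q k * (1 + q ^ (j + k)))"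
  proof (cases k)
    case (Suc i)
    have n: "n = m + i + 2 * j" using assms Suc by simp
    \<comment> \<open>With k = i + 1, kj + binom(k,2) exceeds ij + binom(i,2) by j + i, and n + m =
      2m + j + (j + i).\<close>
    have e: "q ^ (n + m) * q ^ (j\<^sup>2 + i * j + (i choose 2))
        = q ^ (2 * m + j) * q ^ (j\<^sup>2 + k * j + (k choose 2))"
      unfolding power_add[symmetric] n Suc
      by (rule arg_cong[where f = "\<lambda>e. q ^ e"]) (simp add: numeral_2_eq_2 algebra_simps)
    have "?T3 = (q ^ (n + m) * q ^ (j\<^sup>2 + i * j + (i choose 2))) * qfact q n
       * qplus_prod q (m + i + j) /
       (qfact q i * qfact q m * qfact q j * qplus_prod q (m + j) * qplus_prod q (j + i))"
      using Suc by (simp add: normal_coeff_def n)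
    also have "\<dots> = C * (q ^ (2 * m + j) * qnum q k * (1 + q ^ (j + k)))"
      unfolding e C_def using Suc qnum_nonzero[of "Suc i"] one_plus_power_nonzero[of "Suc (j + i)"]
      by (simp add: qfact_Suc qplus_prod_Suc nz divide_simps del: power_Suc)
    finally show ?thesis .
  qed simp
  ultimately show ?thesis
    by (simp only: normal_coeff_identity flip: distrib_left)
qed

section \<open>Expansion of the operator product and comparison with \<open>g_poly\<close> and
  \<open>h_poly\<close>\<close>

lemma op_prod_normal_form:
  "op_prod q s n f =
     (\<Sum>(m, k, j) \<in> {(m, k, j). m + k + 2 * j = n}.
        monom (s ^ (j + k) * normal_coeff q m k j) m * (qderiv q ^^ k) f)"
proof (induction n)
  case 0
  have "{(m, k, j). m + k + 2 * j = (0::nat)} = {(0, 0, 0)}" by auto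
  then show ?case
    by (simp add: normal_coeff_def monom_0 numeral_2_eq_2)
next
  case (Suc n)
  let ?S = "\<lambda>n. {(m, k, j). m + k + 2 * j = (n::nat)}"
  let ?F = "normal_coeff q"
  let ?D = "\<lambda>k. (qderiv q ^^ k) f"
  have fin: "finite (?S n)" for n
    by (rule finite_subset[of _ "{..n} \<times> {..n} \<times> {..n}"]) auto
  \<comment> \<open>\<open>?t1\<close> comes from X, \<open>?t2\<close> and \<open>?t3\<close> from
    the two halves of the Leibniz rule; \<open>?u1\<close>, \<open>?u2\<close>, \<open>?u3\<close>
    are the matching summands of the recurrence, indexed by the triples for n + 1.\<close>
  let ?t1 = "\<lambda>(m, k, j). monom (s ^ (j + k) * ?F m k j) (Suc m) * ?D k"
  let ?t2 = "\<lambda>(m, k, j). monom (q ^ n * s ^ Suc (j + k) * qnum q m * ?F m k j) (m - 1) * ?D k"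
  let ?t3 = "\<lambda>(m, k, j). monom (q ^ (n + m) * s ^ Suc (j + k) * ?F m k j) m * ?D (Suc k)"
  let ?u1 = "\<lambda>(m, k, j). monom (s ^ (j + k) * (if m = 0 then 0 else ?F (m - 1) k j)) m * ?D k"
  let ?u2 = "\<lambda>(m, k, j). monom (s ^ (j + k) * (if j = 0 then 0
      else q ^ n * qnum q (m + 1) * ?F (m + 1) k (j - 1))) m * ?D k"
  let ?u3 = "\<lambda>(m, k, j). monom (s ^ (j + k) * (if k = 0 then 0
      else q ^ (n + m) * ?F m (k - 1) j)) m * ?D k"
  have X: "[:0, 1:] * (monom c m * p) = monom c (Suc m) * p" for c :: 'a and m p
    by (simp add: monom_altdef)
  have "op_prod q s (Suc n) f = sum ?t1 (?S n) + sum ?t2 (?S n) + sum ?t3 (?S n)"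
    unfolding op_prod.simps o_def Suc.IH mult_op_def qderiv_sum[OF q_neq_1]
      sum_distrib_left smult_sum_right sum.distrib[symmetric]
    by (rule sum.cong[OF refl])
       (clarsimp simp: qderiv_monom_mult[OF q_neq_1] X smult_add_right smult_monom_mult
          simp del: mult_pCons_left, simp add: power_add mult_2 mult_2_right ac_simps)
  \<comment> \<open>In each of the three index shifts, \<open>T'\<close> holds the new triples
    without a preimage, where the guard makes the summand zero.\<close>
  moreover have "sum ?t1 (?S n) = sum ?u1 (?S (Suc n))"
    by (rule sum.reindex_bij_witness_not_neutral
          [where S' = "{}" and T' = "{p \<in> ?S (Suc n). fst p = 0}"
             and i = "\<lambda>(m, k, j). (m - 1, k, j)" and j = "\<lambda>(m, k, j). (Suc m, k, j)"])
       (auto intro: finite_subset[OF _ fin])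
  \<comment> \<open>Triples with m = 0 have no image, but \<open>?t2\<close> vanishes there. The
    rule still compares summands at their formal images, so they are sent to (0, 0, 0), where the
    guard j = 0 makes \<open>?u2\<close> vanish.\<close>
  moreover have "sum ?t2 (?S n) = sum ?u2 (?S (Suc n))"
    by (rule sum.reindex_bij_witness_not_neutral
          [where S' = "{p \<in> ?S n. fst p = 0}" and T' = "{p \<in> ?S (Suc n). snd (snd p) = 0}"
             and i = "\<lambda>(m, k, j). (Suc m, k, j - 1)"
             and j = "\<lambda>(m, k, j). if m = 0 then (0, 0, 0) else (m - 1, k, Suc j)"])
       (auto intro: finite_subset[OF _ fin] simp: mult.assoc mult.commute[of _ "q ^ n"])
  moreover have "sum ?t3 (?S n) = sum ?u3 (?S (Suc n))"
    by (rule sum.reindex_bij_witness_not_neutral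
          [where S' = "{}" and T' = "{p \<in> ?S (Suc n). fst (snd p) = 0}"
             and i = "\<lambda>(m, k, j). (m, k - 1, j)" and j = "\<lambda>(m, k, j). (m, Suc k, j)"])
       (auto intro: finite_subset[OF _ fin] simp: ac_simps)
  moreover have "sum ?u1 (?S (Suc n)) + sum ?u2 (?S (Suc n)) + sum ?u3 (?S (Suc n)) =
      (\<Sum>(m, k, j) \<in> ?S (Suc n). monom (s ^ (j + k) * ?F m k j) m * ?D k)"
    unfolding sum.distrib[symmetric]
  proof (rule sum.cong[OF refl])
    fix p assume "p \<in> ?S (Suc n)"
    then obtain m k j where p: "p = (m, k, j)" and mkj: "m + k + 2 * j = Suc n" by auto
    show "?u1 p + ?u2 p + ?u3 p
        = (case p of (m, k, j) \<Rightarrow> monom (s ^ (j + k) * ?F m k j) m * ?D k)"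
      unfolding p prod.case normal_coeff_recurrence[OF mkj] distrib_left add_monom[symmetric]
        distrib_right ..
  qed
  ultimately show ?case by (simp only:)
qed

text \<open>With m = n - k - 2j, the q-binomials and the double factorial combine to [n]! / ([k]!
  [m]! [j]! B(j)), and B(j) cancels against the product in \<open>g_poly\<close>, whose denominator
  is B(j+k) / B(j).\<close>

lemma g_poly_normal_coeff:
  assumes "k \<le> n"
  shows "g_poly q s n k =
           (\<Sum>j=0..(n - k) div 2. monom (s ^ j * normal_coeff q (n - k - 2 * j) k j) (n - k - 2 * j))"
  unfolding g_poly_def smult_sum_right smult_monom
proof (rule sum.cong[OF refl])
  fix j assume "j \<in> {0..(n - k) div 2}"
  then obtain m where n: "n = m + k + 2 * j"
    using assms by (metis add.commute add.left_commute atLeastAtMost_iff le_add_diff_inverse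
        less_eq_div_iff_mult_less_eq mult.commute zero_less_numeral)
  have sub: "n - k = m + 2 * j" "n - k - 2 * j = m" "m + 2 * j - 2 * j = m"
    "\<And>i. n - j - i = m + j + k - i"
    using n by auto
  have top: "(\<Prod>i<k. 1 + q ^ (m + j + k - i)) = qplus_prod q (m + k + j) / qplus_prod q (m + j)"
    using qplus_prod_add_rev[of q "m + j" k] by (simp add: qplus_prod_nonzero ac_simps)
  have bot: "(\<Prod>i<k. 1 + q ^ (j + 1 + i)) = qplus_prod q (j + k) / qplus_prod q j"
    using qplus_prod_add[of q j k] by (simp add: qplus_prod_nonzero)
  have odd: "qodd_dfact q j = qfact q (2 * j) / (qplus_prod q j * qfact q j)"
    using qfact_double[of q j] by (simp add: qplus_prod_nonzero qfact_nonzero)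
  have "qbinom q n k *
      (s ^ j * q ^ (j\<^sup>2 + k * j + (k choose 2)) * qbinom q (n - k) (2 * j) * qodd_dfact q j *
       (\<Prod>i<k. (1 + q ^ (n - j - i)) / (1 + q ^ (j + 1 + i))))
      = s ^ j * normal_coeff q m k j"
    unfolding prod_dividef qbinom_def normal_coeff_def sub top bot odd
    by (simp add: n qplus_prod_nonzero qfact_nonzero) (simp add: ac_simps)
  then show "monom (qbinom q n k *
      (s ^ j * q ^ (j\<^sup>2 + k * j + (k choose 2)) * qbinom q (n - k) (2 * j) * qodd_dfact q j *
       (\<Prod>i<k. (1 + q ^ (n - j - i)) / (1 + q ^ (j + 1 + i))))) (n - k - 2 * j)
      = monom (s ^ j * normal_coeff q (n - k - 2 * j) k j) (n - k - 2 * j)"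
    by (simp only: sub)
qed

lemma op_prod_eq_sum_g_poly:
  "op_prod q s n f = (\<Sum>k=0..n. mult_op (g_poly q s n k) (smult (s ^ k) ((qderiv q ^^ k) f)))"
proof -
  let ?t = "\<lambda>m k j. monom (s ^ (j + k) * normal_coeff q m k j) m * (qderiv q ^^ k) f"
  have "(\<Sum>k=0..n. mult_op (g_poly q s n k) (smult (s ^ k) ((qderiv q ^^ k) f)))
      = (\<Sum>k=0..n. \<Sum>j=0..(n - k) div 2. ?t (n - k - 2 * j) k j)"
    by (rule sum.cong[OF refl])
       (simp add: g_poly_normal_coeff mult_op_def sum_distrib_right smult_sum_right
          smult_monom_mult, simp add: power_add ac_simps)
  also have "\<dots> = (\<Sum>(k, j) \<in> (SIGMA k:{0..n}. {0..(n - k) div 2}). ?t (n - k - 2 * j) k j)"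
    by (simp add: sum.Sigma)
  also have "\<dots> = (\<Sum>(m, k, j) \<in> {(m, k, j). m + k + 2 * j = n}. ?t m k j)"
    by (rule sum.reindex_bij_witness
          [where i = "\<lambda>(m, k, j). (k, j)" and j = "\<lambda>(k, j). (n - k - 2 * j, k, j)"]) auto
  finally show ?thesis
    by (simp only: op_prod_normal_form)
qed

text \<open>At k = 0 the factors B(m+k+j) and B(m+j) cancel, and B(j+k) becomes the product B(j) in
  \<open>h_poly\<close>.\<close>

lemma g_poly_0_eq_h_poly: "g_poly q s n 0 = h_poly q s n"
  unfolding g_poly_normal_coeff[OF le0] h_poly_def
proof (rule sum.cong)
  fix j assume "j \<in> {0..n div 2}"
  then have "n - 2 * j + 2 * j = n" by auto
  then show "monom (s ^ j * normal_coeff q (n - 0 - 2 * j) 0 j) (n - 0 - 2 * j) =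
      monom (q ^ j\<^sup>2 * s ^ j *
        (qfact q n / ((\<Prod>i=1..j. 1 + q ^ i) * qfact q j * qfact q (n - 2 * j)))) (n - 2 * j)"
    unfolding qplus_prod_def[symmetric]
    by (simp add: normal_coeff_def qplus_prod_nonzero binomial_eq_0 ac_simps)
qed simp

end

text \<open>The power is the image of a monomial of degree i > 0, while 1 has degree 0; this works
  in every characteristic.\<close>

lemma q_indet_power_neq_1:
  assumes "i > 0"
  shows "(q_indet :: 'k::field ratfun2) ^ i \<noteq> 1"
proof -
  have pow: "(q_indet :: 'k ratfun2) ^ i = Fract [:monom 1 i:] 1" for i
    by (induction i) (simp_all add: q_indet_def One_fract_def monom_altdef flip: one_pCons)
  have "monom (1::'k) i \<noteq> [:1:]"
    using assms by (metis degree_monom_eq degree_pCons_0 less_irrefl zero_neq_one)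
  then show ?thesis
    by (simp add: pow One_fract_def eq_fract one_pCons)
qed

theorem theorem2:
  fixes q s :: "'k::field ratfun2" and n :: nat
  assumes "q = q_indet" and "s = s_indet"
  shows "op_prod q s n =
           (\<lambda>f. \<Sum>k=0..n. mult_op (g_poly q s n k) (smult (s ^ k) ((qderiv q ^^ k) f)))
         \<and> g_poly q s n 0 = h_poly q s n"
proof -
  have "q ^ i \<noteq> 1" if "i > 0" for i
    using that by (simp only: assms(1) q_indet_power_neq_1 not_False_eq_True)
  then show ?thesis
    using op_prod_eq_sum_g_poly[of q s n] g_poly_0_eq_h_poly[of q s n] by blast
qed

end
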